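(* Let $p\in(0,1)$. Suppose that $F\in \mathcal{F}^{-}_{1}$, and let $F_1,F_2,\ldots \in \mathcal{F}^{-}_{1}$ be any sequence of (possibly random) cdf's such that $$F_n^{-1}(p) \stackrel{\mathbb{P}}{\to} F^{-1}(p) \quad\text{and}\quad A_n\sup_{x\in \mathbb{R}} \big| F_n(x) - F(x)\big| =O_{\mathbb{P}}(1)$$ with some normalizing constants $A_n\to \infty$ when $n\to \infty$. Then $$A_n\left( \int_0^p F_n^{-1}(u)\, du - \int_0^p F^{-1}(u)\, du \right) =A_n\int_{-\infty }^{F^{-1}(p)} \big( F(x)- F_n(x)\big)\, dx +o_{\mathbb{P}}(1)$$ and, therefore, for a random variable $\mathcal{L}(p)$, the convergence-in-distribution statement $$A_n\left( \int_0^p F_n^{-1}(u)\, du - \int_0^p F^{-1}(u)\, du \right) \stackrel{d}{\to} \mathcal{L}(p)$$ holds if and only if $$A_n\left( \int_{-\infty }^{F^{-1}(p)} F_n(x)\, dx - \int_{-\infty }^{F^{-1}(p)} F(x)\, dx \right) \stackrel{d}{\to} - \mathcal{L}(p) .$$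
   Context: The quantile function of a cdf $F$ is $F^{-1}(u)=\inf\{x\in\mathbb{R}: F(x)\ge u\}$ for $u\in(0,1]$ and $F^{-1}(0)=\lim_{u\downarrow 0}F^{-1}(u)$. The class $\mathcal{F}^{-}_{1}$ consists of all (deterministic) cdf's $F$ for which $\int_0^p F^{-1}(u)\,du$ is finite (for $p\in(0,1)$); equivalently, $\mathbb{E}(X^{-})<\infty$ for $X\sim F$, where $X^{-}=(-X)\vee 0$. The cdf $F$ and the constants $A_n$ are deterministic. The $F_n$ may be random: on an underlying probability space $(\Omega,\mathcal{A},\mathbb{P})$, $F_n:\Omega\times\mathbb{R}\to[0,1]$ is jointly measurable and $F_n(\omega,\cdot)$ is a cdf for almost all $\omega$; $F_n\in\mathcal{F}^{-}_{1}$ means that $F_n(\omega,\cdot)\in\mathcal{F}^{-}_{1}$ for almost all $\omega$. No particular sampling design or dependence structure is assumed. $\stackrel{\mathbb{P}}{\to}$ and $\stackrel{d}{\to}$ denote convergence in probability and in distribution; $O_{\mathbb{P}}(1)$ and $o_{\mathbb{P}}(1)$ denote boundedness in probability and convergence to $0$ in probability as $n\to\infty$. *)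

theory Defs
  imports "HOL-Probability.Probability"
begin

definition is_cdf :: "(real \<Rightarrow> real) \<Rightarrow> bool" where
  "is_cdf F \<longleftrightarrow> (\<exists>D. real_distribution D \<and> F = cdf D)"

text \<open>
  The quantile function takes values in the extended reals: it may be infinite at \<open>0\<close> and \<open>1\<close>,
  and is finite on \<open>(0,1)\<close>. Arguments outside \<open>[0,1]\<close> are irrelevant.
\<close>

definition quantile :: "(real \<Rightarrow> real) \<Rightarrow> real \<Rightarrow> ereal" where
  "quantile F u =
    (if u = 0 then Lim (at_right 0) (\<lambda>v. INF x\<in>{x. v \<le> F x}. ereal x)
     else INF x\<in>{x. u \<le> F x}. ereal x)"

text \<open>
  On \<open>(0,p)\<close> with \<open>p < 1\<close> the quantile function is bounded above by its value at \<open>p\<close>, so its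
  integral always exists in \<open>[-\<infinity>,\<infinity>)\<close>, and it is finite exactly if the function is Lebesgue
  integrable. The library's interval integral ignores the endpoints of the interval.
\<close>

definition F1_minus :: "(real \<Rightarrow> real) set" where
  "F1_minus = {F. is_cdf F \<and>
     (\<forall>p\<in>{0<..<1}. interval_lebesgue_integrable lborel 0 (ereal p)
        (\<lambda>u. real_of_ereal (quantile F u)))}"

definition random_cdf :: "'a measure \<Rightarrow> ('a \<Rightarrow> real \<Rightarrow> real) \<Rightarrow> bool" where
  "random_cdf M G \<longleftrightarrow>
     (\<lambda>(\<omega>, x). G \<omega> x) \<in> borel_measurable (M \<Otimes>\<^sub>M borel) \<and>
     (\<forall>\<omega>\<in>space M. \<forall>x. G \<omega> x \<in> {0..1}) \<and>
     (AE \<omega> in M. is_cdf (G \<omega>))"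

text \<open>
  A random cdf is a cdf only almost surely, and on the exceptional null set quantities such as
  \<open>sup\<^sub>x \<bar>G \<omega> x - F x\<bar>\<close> or the quantile need not be measurable in \<open>\<omega>\<close>. They agree almost surely
  with measurable functions, however, so probabilities of events are taken with respect to the
  completion of the underlying probability measure; without the completion the library would
  assign measure \<open>0\<close> to any non-measurable event.
\<close>

definition tendsto_in_prob ::
    "'a measure \<Rightarrow> (nat \<Rightarrow> 'a \<Rightarrow> real) \<Rightarrow> ('a \<Rightarrow> real) \<Rightarrow> bool" where
  "tendsto_in_prob M X Y \<longleftrightarrow>
     (\<forall>\<epsilon>>0. (\<lambda>n. measure (completion M) {\<omega>\<in>space M. \<epsilon> < \<bar>X n \<omega> - Y \<omega>\<bar>}) \<longlonglongrightarrow> 0)"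

abbreviation op1 :: "'a measure \<Rightarrow> (nat \<Rightarrow> 'a \<Rightarrow> real) \<Rightarrow> bool" where
  "op1 M X \<equiv> tendsto_in_prob M X (\<lambda>_. 0)"

definition Op1 :: "'a measure \<Rightarrow> (nat \<Rightarrow> 'a \<Rightarrow> real) \<Rightarrow> bool" where
  "Op1 M X \<longleftrightarrow>
     (\<forall>\<epsilon>>0. \<exists>K. \<forall>\<^sub>F n in sequentially.
        measure (completion M) {\<omega>\<in>space M. K < \<bar>X n \<omega>\<bar>} < \<epsilon>)"

text \<open>The limit may live on a probability space \<open>N\<close> other than that of the sequence.\<close>

definition tendsto_in_distr ::
    "'a measure \<Rightarrow> (nat \<Rightarrow> 'a \<Rightarrow> real) \<Rightarrow> 'b measure \<Rightarrow> ('b \<Rightarrow> real) \<Rightarrow> bool" where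
  "tendsto_in_distr M X N L \<longleftrightarrow>
     weak_conv_m (\<lambda>n. distr (completion M) borel (X n)) (distr N borel L)"

end

theory Submission
  imports Defs
begin

text \<open>
  Write \<open>q\<close> and \<open>q\<^sub>n\<close> for the \<open>p\<close>-quantiles of \<open>F\<close> and \<open>F\<^sub>n\<close>. Tonelli's theorem applied to the
  region \<open>{(u, x). 0 < u < p, x < q, u \<le> F x}\<close> turns the integral of the quantile function over
  \<open>(0, p)\<close> into \<open>p q\<close> minus the integral of \<open>F\<close> over \<open>(-\<infinity>, q)\<close>. Subtracting these identities for
  \<open>F\<^sub>n\<close> and \<open>F\<close>, the error of the claimed expansion, before scaling by \<open>A\<^sub>n\<close>, is the integral of
  \<open>p - F\<^sub>n\<close> from \<open>q\<close> to \<open>q\<^sub>n\<close>. Between \<open>q\<close> and \<open>q\<^sub>n\<close> the level \<open>p\<close> separates \<open>F\<close> from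
  \<open>F\<^sub>n\<close>, so the error is at most \<open>\<bar>q\<^sub>n - q\<bar> sup \<bar>F\<^sub>n - F\<bar>\<close>. After scaling this is the product of an
  \<open>o\<^sub>P(1)\<close> and an \<open>O\<^sub>P(1)\<close> term. The equivalence of the two limit laws is then Slutsky's lemma,
  obtained from Levy's continuity theorem.
\<close>

section \<open>Distribution functions and their quantiles\<close>

lemma is_cdfD:
  assumes "is_cdf F"
  shows is_cdf_mono: "x \<le> y \<Longrightarrow> F x \<le> F y"
    and is_cdf_nonneg: "0 \<le> F x"
    and is_cdf_le_1: "F x \<le> 1"
    and is_cdf_right_cont: "continuous (at_right x) F"
    and is_cdf_at_top: "(F \<longlongrightarrow> 1) at_top"
    and is_cdf_at_bot: "(F \<longlongrightarrow> 0) at_bot"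
    and borel_measurable_is_cdf: "F \<in> borel_measurable borel"
proof -
  obtain D where D: "real_distribution D" "F = cdf D"
    using assms by (auto simp: is_cdf_def)
  interpret real_distribution D by fact
  show "x \<le> y \<Longrightarrow> F x \<le> F y" "0 \<le> F x" "F x \<le> 1" "continuous (at_right x) F"
    "(F \<longlongrightarrow> 1) at_top" "(F \<longlongrightarrow> 0) at_bot"
    unfolding D(2)
    by (rule cdf_nondecreasing cdf_nonneg cdf_bounded_prob cdf_is_right_cont cdf_lim_at_top_prob
        cdf_lim_at_bot | assumption)+
  show "F \<in> borel_measurable borel"
    unfolding D(2) by (intro borel_measurable_mono monoI cdf_nondecreasing)
qed

text \<open>Right continuity makes the infimum attained, so the superlevel set is a closed
  half-line. Later arguments compare quantiles through this equivalence and never return to the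
  infimum.\<close>

lemma quantile_galois:
  assumes F: "is_cdf F" and u: "0 < u" "u < 1"
  shows quantile_eq_ereal: "quantile F u = ereal (real_of_ereal (quantile F u))"
    and quantile_le_iff: "real_of_ereal (quantile F u) \<le> x \<longleftrightarrow> u \<le> F x"
proof -
  let ?S = "{x. u \<le> F x}"
  define q where "q = Inf ?S"
  obtain b where "u < F b"
    using order_tendstoD(1)[OF is_cdf_at_top[OF F] u(2)] by (auto simp: eventually_at_top_linorder)
  then have ne: "?S \<noteq> {}" by (auto intro!: exI[of _ b])
  obtain c where "\<And>x. x \<le> c \<Longrightarrow> F x < u"
    using order_tendstoD(2)[OF is_cdf_at_bot[OF F] u(1)] by (auto simp: eventually_at_bot_linorder)
  then have bdd: "bdd_below ?S"
    by (intro bdd_belowI[of _ c]) (metis linorder_le_cases mem_Collect_eq not_le)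
  \<comment> \<open>By monotonicity every point to the right of \<open>q\<close> lies in
    \<open>?S\<close>. Right continuity then carries the inequality to \<open>q\<close>
    itself.\<close>
  have "eventually (\<lambda>x. u \<le> F x) (at_right q)"
  proof -
    have "u \<le> F x" if "q < x" for x
      using that is_cdf_mono[OF F] cInf_less_iff[OF ne bdd, of x]
      unfolding q_def by (metis less_imp_le mem_Collect_eq order_trans)
    then show ?thesis by (auto simp: eventually_at_right_field intro!: exI[of _ "q + 1"])
  qed
  then have "u \<le> F q"
    using is_cdf_right_cont[OF F, of q] unfolding continuous_within
    by (intro tendsto_lowerbound[of F "F q" "at_right q"]) auto
  then have S: "?S = {q..}"
    using cInf_lower[OF _ bdd] is_cdf_mono[OF F] unfolding q_def by (auto intro: order_trans)
  have "quantile F u = ereal q"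
    unfolding quantile_def S using u
    by (auto intro!: antisym INF_lower2[of q] INF_greatest)
  then show "quantile F u = ereal (real_of_ereal (quantile F u))"
    "real_of_ereal (quantile F u) \<le> x \<longleftrightarrow> u \<le> F x"
    using S by auto
qed

section \<open>The integrated quantile function and the error of its expansion\<close>

lemma integral_quantile:
  assumes F: "F \<in> F1_minus" and p: "0 < p" "p < 1"
  defines "q \<equiv> real_of_ereal (quantile F p)"
  shows "set_integrable lborel {..<q} F"
    and "(LBINT u=0..ereal p. real_of_ereal (quantile F u)) = p * q - (LBINT x:{..<q}. F x)"
proof -
  have cdf: "is_cdf F" using F by (simp add: F1_minus_def)
  note [measurable] = borel_measurable_is_cdf[OF cdf]
  define Q where "Q u = real_of_ereal (quantile F u)" for u
  have gal: "Q u \<le> x \<longleftrightarrow> u \<le> F x" if "0 < u" "u < p" for u x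
    using quantile_le_iff[OF cdf] that p by (auto simp: Q_def)
  have galq: "q \<le> x \<longleftrightarrow> p \<le> F x" for x
    using quantile_le_iff[OF cdf p] by (simp add: q_def)
  have e: "einterval 0 (ereal p) = {0<..<p}"
    unfolding zero_ereal_def by simp
  have intQ: "set_integrable lborel {0<..<p} Q"
    using F p by (auto simp: F1_minus_def interval_lebesgue_integrable_def Q_def[abs_def] simp flip: e)
  have intc: "set_integrable lborel {0<..<p} (\<lambda>u. q)"
    unfolding set_integrable_def using p by simp
  have intd: "set_integrable lborel {0<..<p} (\<lambda>u. q - Q u)"
    by (intro set_integral_diff intQ intc)
  have Qle: "Q u \<le> q" if "0 < u" "u < p" for u
    using gal[OF that] galq[of q] that by auto
  \<comment> \<open>The slice of this region at fixed \<open>u\<close> is \<open>{Q u..<q}\<close>,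
    of length \<open>q - Q u\<close>; the slice at fixed \<open>x < q\<close> is
    \<open>{0<..F x}\<close>, of length \<open>F x\<close>.\<close>
  let ?f = "\<lambda>u x. indicator {(u, x). 0 < u \<and> u < p \<and> x < q \<and> u \<le> F x} (u, x) :: ennreal"
  have 1: "(\<integral>\<^sup>+x. ?f u x \<partial>lborel) = ennreal (indicator {0<..<p} u *\<^sub>R (q - Q u))" for u
  proof (cases "0 < u \<and> u < p")
    case True
    then have "(\<integral>\<^sup>+x. ?f u x \<partial>lborel) = (\<integral>\<^sup>+x. indicator {Q u..<q} x \<partial>lborel)"
      by (intro nn_integral_cong) (auto simp: indicator_def gal)
    then show ?thesis using True Qle by simp
  qed (auto simp: indicator_def)
  have 2: "(\<integral>\<^sup>+u. ?f u x \<partial>lborel) = ennreal (indicator {..<q} x *\<^sub>R F x)" for x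
  proof (cases "x < q")
    case True
    \<comment> \<open>Below the quantile the constraint \<open>u < p\<close> thus follows from
      \<open>u \<le> F x\<close>, so the slice is not cut off at \<open>p\<close>.\<close>
    then have "F x < p" using galq[of x] by auto
    then have "(\<integral>\<^sup>+u. ?f u x \<partial>lborel) = (\<integral>\<^sup>+u. indicator {0<..F x} u \<partial>lborel)"
      using True by (intro nn_integral_cong) (auto simp: indicator_def)
    then show ?thesis using True is_cdf_nonneg[OF cdf] by simp
  qed (auto simp: indicator_def)
  have "{z \<in> space (borel \<Otimes>\<^sub>M borel). 0 < fst z \<and> fst z < p \<and> snd z < q \<and> fst z \<le> F (snd z)}
      \<in> sets (borel \<Otimes>\<^sub>M borel)"
    by measurable
  then have meas: "{(u, x). 0 < u \<and> u < p \<and> x < q \<and> u \<le> F x} \<in> sets (lborel \<Otimes>\<^sub>M lborel)"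
    by (simp add: space_pair_measure split_beta' cong: sets_pair_measure_cong)
  have eq: "(\<integral>\<^sup>+x. ennreal (indicator {..<q} x *\<^sub>R F x) \<partial>lborel)
      = (\<integral>\<^sup>+u. ennreal (indicator {0<..<p} u *\<^sub>R (q - Q u)) \<partial>lborel)"
    unfolding 1[symmetric] 2[symmetric] using meas
    by (intro lborel_pair.Fubini') (simp add: split_beta')
  have d0: "0 \<le> indicator {0<..<p} u *\<^sub>R (q - Q u)" for u
    using Qle by (auto simp: indicator_def)
  have F0: "0 \<le> indicator {..<q} x *\<^sub>R F x" for x
    using is_cdf_nonneg[OF cdf] by (auto simp: indicator_def)
  \<comment> \<open>Finiteness passes from the quantile side to the cdf side: \<open>F\<close> is
    nonnegative and its integral equals that of the integrable function
    \<open>q - Q u\<close>.\<close>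
  have eq': "(\<integral>\<^sup>+x. ennreal (indicator {..<q} x *\<^sub>R F x) \<partial>lborel)
      = ennreal (LBINT u:{0<..<p}. q - Q u)"
    unfolding eq set_lebesgue_integral_def
    using intd d0 by (intro nn_integral_eq_integral) (auto simp: set_integrable_def)
  show "set_integrable lborel {..<q} F"
    unfolding set_integrable_def
    by (rule integrableI_nonneg) (use F0 eq' in auto)
  have "(LBINT x:{..<q}. F x) = (LBINT u:{0<..<p}. q - Q u)"
    unfolding set_lebesgue_integral_def
    by (subst integral_eq_nn_integral)
      (use F0 eq' d0 in \<open>auto simp: set_lebesgue_integral_def intro!: Bochner_Integration.integral_nonneg\<close>)
  also have "\<dots> = p * q - (LBINT u:{0<..<p}. Q u)"
    using set_integral_diff(2)[OF intc intQ] p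
    by (simp add: set_lebesgue_integral_def)
  finally show "(LBINT u=0..ereal p. real_of_ereal (quantile F u)) = p * q - (LBINT x:{..<q}. F x)"
    using p by (simp add: interval_lebesgue_integral_def e Q_def[abs_def])
qed

lemma set_integrable_Ico_is_cdf:
  assumes "is_cdf F"
  shows "set_integrable lborel {a..<b::real} F"
proof -
  note [measurable] = borel_measurable_is_cdf[OF assms]
  have "set_integrable lborel {a..<b} (\<lambda>x. 1::real)"
    by (cases "a \<le> b") (auto simp: set_integrable_def)
  then show ?thesis
    by (rule set_integrable_bound)
      (use is_cdf_nonneg[OF assms] is_cdf_le_1[OF assms] in \<open>auto simp: set_borel_measurable_def\<close>)
qed

lemma set_integrable_lessThan_F1_minus:
  assumes F: "F \<in> F1_minus"
  shows "set_integrable lborel {..<a} F"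
proof -
  \<comment> \<open>The level 1/2 is arbitrary: any quantile serves as a base point with an
    integrable left tail, and beyond it only a bounded interval remains.\<close>
  let ?q = "real_of_ereal (quantile F (1/2))"
  have "set_integrable lborel ({..<?q} \<union> {?q..<a}) F"
    using integral_quantile(1)[OF F, of "1/2"] set_integrable_Ico_is_cdf[of F] F
    by (intro set_integrable_Un) (auto simp: F1_minus_def)
  then show ?thesis by (rule set_integrable_subset) auto
qed

lemma set_integral_lessThan_F1_minus_split:
  assumes F: "F \<in> F1_minus" and "a \<le> b"
  shows "(LBINT x:{..<b}. F x) = (LBINT x:{..<a}. F x) + (LBINT x:{a..<b}. F x)"
proof -
  have "{..<b} = {..<a} \<union> {a..<b}" using assms(2) by auto
  then show ?thesis
    using set_integrable_lessThan_F1_minus[OF F] set_integrable_Ico_is_cdf[of F] F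
    by (auto intro!: set_integral_Un simp: F1_minus_def)
qed

lemma abs_set_integral_diff_const_le:
  fixes f :: "real \<Rightarrow> real"
  assumes f: "set_integrable lborel {a..<b} f" and "a \<le> b"
    and le: "\<And>x. a \<le> x \<Longrightarrow> x < b \<Longrightarrow> \<bar>f x - c\<bar> \<le> S"
  shows "\<bar>(LBINT x:{a..<b}. f x) - c * (b - a)\<bar> \<le> S * (b - a)"
proof -
  have const: "set_integrable lborel {a..<b} (\<lambda>x. k)" "(LBINT x:{a..<b}. k) = k * (b - a)" for k :: real
    using assms(2) by (auto simp: set_integrable_def set_lebesgue_integral_def)
  have "(LBINT x:{a..<b}. c - S) \<le> (LBINT x:{a..<b}. f x)" "(LBINT x:{a..<b}. f x) \<le> (LBINT x:{a..<b}. c + S)"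
    by (intro set_integral_mono const f; use le in \<open>force simp: abs_le_iff\<close>)+
  then show ?thesis unfolding const by (auto simp: algebra_simps abs_le_iff)
qed

lemma LBINT_quantile_eq:
  assumes "is_cdf F" "0 < p" "p < 1"
  shows "(LBINT x=-\<infinity>..quantile F p. f x) = (LBINT x:{..<real_of_ereal (quantile F p)}. f x :: real)"
  by (subst quantile_eq_ereal[OF assms]) (simp add: interval_lebesgue_integral_def)

lemma lorenz_remainder_le:
  assumes F: "F \<in> F1_minus" and G: "G \<in> F1_minus" and p: "0 < p" "p < 1"
  shows "\<bar>((LBINT u=0..ereal p. real_of_ereal (quantile G u))
          - (LBINT u=0..ereal p. real_of_ereal (quantile F u)))
        - (LBINT x=-\<infinity>..quantile F p. F x - G x)\<bar>
      \<le> \<bar>real_of_ereal (quantile G p) - real_of_ereal (quantile F p)\<bar> * (SUP x. \<bar>G x - F x\<bar>)"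
    (is "\<bar>?R\<bar> \<le> \<bar>?b - ?a\<bar> * ?S")
proof -
  have cF: "is_cdf F" and cG: "is_cdf G" using F G by (auto simp: F1_minus_def)
  have "\<bar>G x - F x\<bar> \<le> 1" for x
    using is_cdf_nonneg[OF cF, of x] is_cdf_le_1[OF cF, of x]
      is_cdf_nonneg[OF cG, of x] is_cdf_le_1[OF cG, of x] by linarith
  \<comment> \<open>The uniform bound 1 is what makes the real-valued supremum an upper
    bound.\<close>
  then have S: "\<bar>G x - F x\<bar> \<le> ?S" for x
    by (intro cSUP_upper bdd_aboveI2) auto
  note galF = quantile_le_iff[OF cF p] and galG = quantile_le_iff[OF cG p]
  \<comment> \<open>The two integrals of \<open>F\<close> up to \<open>?a\<close> cancel, which
    leaves only increments of \<open>G\<close>.\<close>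
  have R: "?R = p * (?b - ?a) - ((LBINT x:{..<?b}. G x) - (LBINT x:{..<?a}. G x))"
    unfolding integral_quantile(2)[OF F p] integral_quantile(2)[OF G p] LBINT_quantile_eq[OF cF p]
    by (subst set_integral_diff) (auto intro: set_integrable_lessThan_F1_minus F G simp: algebra_simps)
  show ?thesis
  proof (cases "?a \<le> ?b")
    case True
    have "\<bar>(LBINT x:{?a..<?b}. G x) - p * (?b - ?a)\<bar> \<le> ?S * (?b - ?a)"
    proof (rule abs_set_integral_diff_const_le[OF set_integrable_Ico_is_cdf[OF cG] True])
      fix x assume "?a \<le> x" "x < ?b"
      \<comment> \<open>Here \<open>G x < p \<le> F x\<close>, so the distance of \<open>G x\<close>
        to \<open>p\<close> is at most that to \<open>F x\<close>.\<close>
      then show "\<bar>G x - p\<bar> \<le> ?S" using galF[of x] galG[of x] S[of x] by linarith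
    qed
    then show ?thesis
      unfolding R set_integral_lessThan_F1_minus_split[OF G True] using True
      by (simp add: algebra_simps abs_minus_commute)
  next
    case False
    then have le: "?b \<le> ?a" by simp
    have "\<bar>(LBINT x:{?b..<?a}. G x) - p * (?a - ?b)\<bar> \<le> ?S * (?a - ?b)"
    proof (rule abs_set_integral_diff_const_le[OF set_integrable_Ico_is_cdf[OF cG] le])
      fix x assume "?b \<le> x" "x < ?a"
      \<comment> \<open>The order is reversed: \<open>F x < p \<le> G x\<close>.\<close>
      then show "\<bar>G x - p\<bar> \<le> ?S" using galF[of x] galG[of x] S[of x] by linarith
    qed
    then show ?thesis
      unfolding R set_integral_lessThan_F1_minus_split[OF G le] using le
      by (simp add: algebra_simps)
  qed
qed

section \<open>Null sets, the completion, and stochastic order symbols\<close>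

lemma pred_cong_AE_completion:
  assumes "Measurable.pred (completion M) P" "AE x in M. P x \<longleftrightarrow> Q x"
  shows "Measurable.pred (completion M) Q"
proof -
  note [measurable] = assms(1)
  have [measurable]: "Measurable.pred (completion M) (\<lambda>x. \<not> (P x \<longleftrightarrow> Q x))"
    using assms(2) by (intro sets_completion_AE) auto
  \<comment> \<open>\<open>Q\<close> is the exclusive or of \<open>P\<close> with the null set on
    which they differ, and the completion measures that set.\<close>
  have "Measurable.pred (completion M) (\<lambda>x. P x \<noteq> (\<not> (P x \<longleftrightarrow> Q x)))"
    by measurable
  also have "(\<lambda>x. P x \<noteq> (\<not> (P x \<longleftrightarrow> Q x))) = Q" by auto
  finally show ?thesis .
qed

lemma borel_measurable_completion_cong_AE:
  fixes f g :: "'a \<Rightarrow> real"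
  assumes [measurable]: "f \<in> borel_measurable (completion M)" and "AE x in M. f x = g x"
  shows "g \<in> borel_measurable (completion M)"
proof -
  have "Measurable.pred (completion M) (\<lambda>x. g x \<le> c)" for c
    by (rule pred_cong_AE_completion[where P = "\<lambda>x. f x \<le> c"]) (use assms(2) in auto)
  then show ?thesis by (simp add: borel_measurable_iff_le pred_def)
qed

text \<open>Off two events of small probability one factor is at most \<open>\<epsilon> / k\<close>
  and the other at most \<open>k\<close>. \<open>R\<close> enters only through an almost sure bound,
  so the lemma applies directly to the expansion error.\<close>

lemma op1_mult_Op1:
  assumes "prob_space M" and Z: "tendsto_in_prob M Z Y" and B: "Op1 M B"
    and [measurable]: "\<And>n. Z n \<in> borel_measurable (completion M)" "Y \<in> borel_measurable (completion M)"
      "\<And>n. B n \<in> borel_measurable (completion M)"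
    and le: "\<And>n. AE \<omega> in M. \<bar>R n \<omega>\<bar> \<le> \<bar>Z n \<omega> - Y \<omega>\<bar> * \<bar>B n \<omega>\<bar>"
  shows "op1 M R"
  unfolding tendsto_in_prob_def
proof (intro allI impI)
  interpret prob_space "completion M"
    by (rule prob_space.prob_space_completion[OF assms(1)])
  fix \<epsilon> :: real assume \<epsilon>: "0 < \<epsilon>"
  show "(\<lambda>n. measure (completion M) {\<omega>\<in>space M. \<epsilon> < \<bar>R n \<omega> - 0\<bar>}) \<longlonglongrightarrow> 0"
  proof (rule order_tendstoI)
    fix e :: real assume e: "0 < e"
    obtain K where K: "\<forall>\<^sub>F n in sequentially. prob {\<omega>\<in>space M. K < \<bar>B n \<omega>\<bar>} < e / 2"
      using B e unfolding Op1_def by (meson half_gt_zero)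
    \<comment> \<open>The maximum with 1 keeps the divisor in \<open>\<epsilon> / k\<close> positive
      while \<open>k\<close> still dominates \<open>K\<close>.\<close>
    define k where "k = max K 1"
    have k: "0 < k" "K \<le> k" by (auto simp: k_def)
    have "\<forall>\<^sub>F n in sequentially. prob {\<omega>\<in>space M. \<epsilon> / k < \<bar>Z n \<omega> - Y \<omega>\<bar>} < e / 2"
      using Z \<epsilon> k e by (intro order_tendstoD(2)[where y = 0]) (auto simp: tendsto_in_prob_def)
    with K show "\<forall>\<^sub>F n in sequentially. prob {\<omega>\<in>space M. \<epsilon> < \<bar>R n \<omega> - 0\<bar>} < e"
    proof eventually_elim
      case (elim n)
      let ?C = "{\<omega>\<in>space M. \<epsilon> / k < \<bar>Z n \<omega> - Y \<omega>\<bar>}" and ?D = "{\<omega>\<in>space M. K < \<bar>B n \<omega>\<bar>}"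
      have sets: "?C \<in> events" "?D \<in> events"
        unfolding space_completion[of M, symmetric] by measurable
      have *: "\<bar>Z n \<omega> - Y \<omega>\<bar> * \<bar>B n \<omega>\<bar> \<le> \<epsilon>"
        if "\<bar>Z n \<omega> - Y \<omega>\<bar> \<le> \<epsilon> / k" "\<bar>B n \<omega>\<bar> \<le> K" for \<omega>
        using mult_mono[of "\<bar>Z n \<omega> - Y \<omega>\<bar>" "\<epsilon> / k" "\<bar>B n \<omega>\<bar>" k] that k \<epsilon> by auto
      have "AE \<omega> in completion M. \<omega> \<in> {\<omega>\<in>space M. \<epsilon> < \<bar>R n \<omega> - 0\<bar>} \<longrightarrow> \<omega> \<in> ?C \<union> ?D"
        using AE_completion[OF le[of n]]
      proof eventually_elim
        case (elim \<omega>)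
        then show ?case using *[of \<omega>] by force
      qed
      then have "prob {\<omega>\<in>space M. \<epsilon> < \<bar>R n \<omega> - 0\<bar>} \<le> prob (?C \<union> ?D)"
        using sets by (intro finite_measure_mono_AE) auto
      also have "\<dots> \<le> prob ?C + prob ?D"
        using sets by (intro measure_Un_le)
      finally show ?case using elim by simp
    qed
  qed (auto intro!: always_eventually order.strict_trans2[OF _ measure_nonneg])
qed

section \<open>Convergence in distribution through characteristic functions\<close>

lemma tendsto_in_distr_iff_char:
  assumes M: "prob_space M" and N: "prob_space N"
    and X: "\<And>n. X n \<in> borel_measurable (completion M)" and L: "L \<in> borel_measurable N"
  shows "tendsto_in_distr M X N L \<longleftrightarrow>
    (\<forall>t. (\<lambda>n. CLINT \<omega>|completion M. iexp (t * X n \<omega>)) \<longlonglongrightarrow> (CLINT v|N. iexp (t * L v)))"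
proof -
  have rd: "real_distribution (distr (completion M) borel (X n))" for n
    using prob_space.prob_space_completion[OF M] X by (rule prob_space.real_distribution_distr)
  have rdL: "real_distribution (distr N borel L)"
    using N L by (rule prob_space.real_distribution_distr)
  have c: "char (distr (completion M) borel (X n)) t = (CLINT \<omega>|completion M. iexp (t * X n \<omega>))" for n t
    unfolding char_def using X by (subst integral_distr) auto
  have cL: "char (distr N borel L) t = (CLINT v|N. iexp (t * L v))" for t
    unfolding char_def using L by (subst integral_distr) auto
  show ?thesis
    \<comment> \<open>\<open>levy_continuity1\<close> passes from weak convergence to characteristic
      functions, and \<open>levy_continuity\<close> gives the converse.\<close>
    unfolding tendsto_in_distr_def c[symmetric] cL[symmetric]
    using levy_continuity1[of "\<lambda>n. distr (completion M) borel (X n)", OF rd rdL]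
      levy_continuity[of "\<lambda>n. distr (completion M) borel (X n)", OF rd rdL] by blast
qed

lemma norm_iexp_diff_le: "norm (iexp a - iexp b) \<le> \<bar>a - b\<bar>"
proof -
  have "iexp a - iexp b = iexp b * (iexp (a - b) - 1)"
    by (simp add: algebra_simps flip: exp_add)
  then have "norm (iexp a - iexp b) = norm (iexp (a - b) - 1)"
    by (simp add: norm_mult)
  also have "\<dots> \<le> \<bar>a - b\<bar>" using iexp_approx1[of "a - b" 0] by simp
  finally show ?thesis .
qed

text \<open>Where the variables differ by at most \<open>\<delta>\<close>, the Lipschitz bound for
  \<open>iexp\<close> gives the first term. On the remaining event two numbers of modulus 1 differ
  by at most 2.\<close>

lemma (in prob_space) norm_integral_iexp_diff_le:
  assumes [measurable]: "random_variable borel X" "random_variable borel Y" and "0 < \<delta>"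
  shows "norm ((CLINT \<omega>|M. iexp (t * X \<omega>)) - (CLINT \<omega>|M. iexp (t * Y \<omega>)))
    \<le> \<bar>t\<bar> * \<delta> + 2 * prob {\<omega>\<in>space M. \<delta> < \<bar>X \<omega> - Y \<omega>\<bar>}"
proof -
  let ?D = "{\<omega>\<in>space M. \<delta> < \<bar>X \<omega> - Y \<omega>\<bar>}"
  have int: "integrable M (\<lambda>\<omega>. iexp (t * X \<omega>))" "integrable M (\<lambda>\<omega>. iexp (t * Y \<omega>))"
    by (intro integrable_iexp; simp)+
  have "norm ((CLINT \<omega>|M. iexp (t * X \<omega>)) - (CLINT \<omega>|M. iexp (t * Y \<omega>)))
      = norm (CLINT \<omega>|M. iexp (t * X \<omega>) - iexp (t * Y \<omega>))"
    using int by simp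
  also have "\<dots> \<le> (\<integral>\<omega>. norm (iexp (t * X \<omega>) - iexp (t * Y \<omega>)) \<partial>M)"
    by (rule integral_norm_bound)
  also have "\<dots> \<le> (\<integral>\<omega>. \<bar>t\<bar> * \<delta> + 2 * indicator ?D \<omega> \<partial>M)"
  proof (rule integral_mono)
    fix \<omega> assume \<omega>: "\<omega> \<in> space M"
    have "norm (iexp (t * X \<omega>) - iexp (t * Y \<omega>)) \<le> \<bar>t\<bar> * \<bar>X \<omega> - Y \<omega>\<bar>"
      using norm_iexp_diff_le[of "t * X \<omega>" "t * Y \<omega>"] by (simp flip: abs_mult right_diff_distrib)
    moreover have "\<bar>t\<bar> * \<bar>X \<omega> - Y \<omega>\<bar> \<le> \<bar>t\<bar> * \<delta>" if "\<bar>X \<omega> - Y \<omega>\<bar> \<le> \<delta>"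
      using that by (intro mult_left_mono) auto
    moreover have "norm (iexp (t * X \<omega>) - iexp (t * Y \<omega>)) \<le> 2"
      using norm_triangle_ineq4[of "iexp (t * X \<omega>)" "iexp (t * Y \<omega>)"] by simp
    moreover have "0 \<le> \<bar>t\<bar> * \<delta>" using assms by simp
    ultimately show "norm (iexp (t * X \<omega>) - iexp (t * Y \<omega>)) \<le> \<bar>t\<bar> * \<delta> + 2 * indicator ?D \<omega>"
      using \<omega> by (cases "\<bar>X \<omega> - Y \<omega>\<bar> \<le> \<delta>") (auto simp: indicator_def)
  next
    show "integrable M (\<lambda>\<omega>. norm (iexp (t * X \<omega>) - iexp (t * Y \<omega>)))"
      using int by (intro integrable_norm Bochner_Integration.integrable_diff)
    show "integrable M (\<lambda>\<omega>. \<bar>t\<bar> * \<delta> + 2 * indicator ?D \<omega>)"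
      by (intro Bochner_Integration.integrable_add integrable_const integrable_mult_right
          integrable_real_indicator) (auto simp: emeasure_eq_measure)
  qed
  also have "\<dots> = \<bar>t\<bar> * \<delta> + 2 * prob ?D"
  proof -
    have "integrable M (indicator ?D :: _ \<Rightarrow> real)"
      by (intro integrable_real_indicator) (auto simp: emeasure_eq_measure)
    then show ?thesis by (subst Bochner_Integration.integral_add) (auto simp: prob_space)
  qed
  finally show ?thesis .
qed

text \<open>This is the form of Slutsky's lemma used here: the characteristic functions of
  \<open>X n\<close> and \<open>Y n\<close> differ by a null sequence at each \<open>t\<close>,
  hence have the same limits.\<close>

lemma tendsto_in_distr_cong_op1:
  assumes M: "prob_space M" and N: "prob_space N"
    and X: "\<And>n. X n \<in> borel_measurable (completion M)"
    and Y: "\<And>n. Y n \<in> borel_measurable (completion M)" and L: "L \<in> borel_measurable N"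
    and o: "op1 M (\<lambda>n \<omega>. X n \<omega> - Y n \<omega>)"
  shows "tendsto_in_distr M X N L \<longleftrightarrow> tendsto_in_distr M Y N L"
proof -
  interpret prob_space "completion M" by (rule prob_space.prob_space_completion[OF M])
  have 0: "(\<lambda>n. (CLINT \<omega>|completion M. iexp (t * X n \<omega>)) - (CLINT \<omega>|completion M. iexp (t * Y n \<omega>))) \<longlonglongrightarrow> 0"
    for t
  proof (rule tendsto_norm_zero_cancel, rule order_tendstoI)
    fix e :: real assume e: "0 < e"
    \<comment> \<open>With this choice \<open>\<bar>t\<bar> * \<delta>\<close> stays below
      \<open>e / 2\<close>, the added 1 covering \<open>t = 0\<close>; a probability below
      \<open>e / 4\<close> contributes the other half.\<close>
    define \<delta> where "\<delta> = e / (2 * (\<bar>t\<bar> + 1))"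
    have \<delta>: "0 < \<delta>" "\<bar>t\<bar> * \<delta> < e / 2"
      using e by (auto simp: \<delta>_def field_simps add_pos_nonneg)
    have "\<forall>\<^sub>F n in sequentially. prob {\<omega>\<in>space M. \<delta> < \<bar>X n \<omega> - Y n \<omega>\<bar>} < e / 4"
      using o \<delta> e by (intro order_tendstoD(2)[where y = 0]) (auto simp: tendsto_in_prob_def)
    then show "\<forall>\<^sub>F n in sequentially. norm ((CLINT \<omega>|completion M. iexp (t * X n \<omega>))
        - (CLINT \<omega>|completion M. iexp (t * Y n \<omega>))) < e"
    proof eventually_elim
      case (elim n)
      then show ?case
        using norm_integral_iexp_diff_le[OF X[of n] Y[of n] \<delta>(1), of t] \<delta>(2) by simp
    qed
  qed (auto intro!: always_eventually order.strict_trans2[OF _ norm_ge_zero])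
  have "(\<lambda>n. CLINT \<omega>|completion M. iexp (t * X n \<omega>)) \<longlonglongrightarrow> c
      \<longleftrightarrow> (\<lambda>n. CLINT \<omega>|completion M. iexp (t * Y n \<omega>)) \<longlonglongrightarrow> c" for t c
    by (rule Lim_transform_eq[OF 0])
  then show ?thesis
    unfolding tendsto_in_distr_iff_char[OF M N X L] tendsto_in_distr_iff_char[OF M N Y L] by simp
qed

lemma tendsto_in_distr_uminus:
  assumes M: "prob_space M" and N: "prob_space N"
    and X: "\<And>n. X n \<in> borel_measurable (completion M)" and L: "L \<in> borel_measurable N"
    and XL: "tendsto_in_distr M X N L"
  shows "tendsto_in_distr M (\<lambda>n \<omega>. - X n \<omega>) N (\<lambda>v. - L v)"
proof -
  \<comment> \<open>The characteristic function of \<open>- X n\<close> at \<open>t\<close> is that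
    of \<open>X n\<close> at \<open>- t\<close>.\<close>
  have "(\<lambda>n. CLINT \<omega>|completion M. iexp (t * - X n \<omega>)) \<longlonglongrightarrow> (CLINT v|N. iexp (t * - L v))" for t
    using XL[unfolded tendsto_in_distr_iff_char[OF M N X L], rule_format, of "- t"] by simp
  then show ?thesis
    using X L by (subst tendsto_in_distr_iff_char[OF M N]) auto
qed

section \<open>Measurability of functionals of a random cdf\<close>

lemma random_cdfD:
  assumes "random_cdf M G"
  shows borel_measurable_random_cdf: "(\<lambda>(\<omega>, x). G \<omega> x) \<in> borel_measurable (M \<Otimes>\<^sub>M lborel)"
    and AE_random_cdf: "AE \<omega> in M. is_cdf (G \<omega>)"
    and borel_measurable_random_cdf_at: "(\<lambda>\<omega>. G \<omega> x) \<in> borel_measurable M"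
proof -
  have *: "(\<lambda>(\<omega>, x). G \<omega> x) \<in> borel_measurable (M \<Otimes>\<^sub>M borel)"
    using assms by (simp add: random_cdf_def)
  then show "(\<lambda>(\<omega>, x). G \<omega> x) \<in> borel_measurable (M \<Otimes>\<^sub>M lborel)"
    by (simp cong: measurable_cong_sets sets_pair_measure_cong)
  show "AE \<omega> in M. is_cdf (G \<omega>)" using assms by (simp add: random_cdf_def)
  show "(\<lambda>\<omega>. G \<omega> x) \<in> borel_measurable M"
    using measurable_compose[OF measurable_Pair[OF measurable_ident_sets[OF refl] measurable_const[of x]] *]
    by simp
qed

text \<open>Almost surely a sublevel set of the quantile is described by the value of
  \<open>G \<omega>\<close> at the single point \<open>c\<close>, which is measurable in
  \<open>\<omega>\<close>.\<close>

lemma borel_measurable_quantile_random_cdf: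
  assumes G: "random_cdf M G" and p: "0 < p" "p < 1"
  shows "(\<lambda>\<omega>. real_of_ereal (quantile (G \<omega>) p)) \<in> borel_measurable (completion M)"
proof -
  note [measurable] = borel_measurable_random_cdf_at[OF G]
  have "Measurable.pred (completion M) (\<lambda>\<omega>. real_of_ereal (quantile (G \<omega>) p) \<le> c)" for c
  proof (rule pred_cong_AE_completion)
    show "Measurable.pred (completion M) (\<lambda>\<omega>. p \<le> G \<omega> c)"
      by (rule measurable_completion) measurable
    show "AE \<omega> in M. p \<le> G \<omega> c \<longleftrightarrow> real_of_ereal (quantile (G \<omega>) p) \<le> c"
      using AE_random_cdf[OF G] by eventually_elim (simp add: quantile_le_iff p)
  qed
  then show ?thesis by (simp add: borel_measurable_iff_le pred_def)
qed

text \<open>A violation at \<open>x\<close> would persist on an interval to its right, by right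
  continuity, and so at a rational point. This reduces the uncountable supremum to countably many
  measurable conditions.\<close>

lemma abs_is_cdf_diff_le_on_Rats:
  assumes F: "is_cdf F" and G: "is_cdf G" and le: "\<And>r. r \<in> \<rat> \<Longrightarrow> \<bar>G r - F r\<bar> \<le> c"
  shows "\<bar>G x - F x\<bar> \<le> c"
proof -
  have lim: "((\<lambda>y. \<bar>G y - F y\<bar>) \<longlongrightarrow> \<bar>G x - F x\<bar>) (at_right x)"
    using is_cdf_right_cont[OF F, of x] is_cdf_right_cont[OF G, of x]
    unfolding continuous_within by (intro tendsto_intros)
  show ?thesis
  proof (rule ccontr)
    assume "\<not> ?thesis"
    then have "\<forall>\<^sub>F y in at_right x. c < \<bar>G y - F y\<bar>"
      using order_tendstoD(1)[OF lim] by auto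
    then obtain b where "x < b" "\<And>y. x < y \<Longrightarrow> y < b \<Longrightarrow> c < \<bar>G y - F y\<bar>"
      by (auto simp: eventually_at_right_field)
    moreover obtain r where "r \<in> \<rat>" "x < r" "r < b"
      using Rats_dense_in_real[OF \<open>x < b\<close>] by auto
    ultimately show False using le[of r] by force
  qed
qed

lemma borel_measurable_sup_random_cdf:
  assumes G: "random_cdf M G" and F: "is_cdf F"
  shows "(\<lambda>\<omega>. SUP x. \<bar>G \<omega> x - F x\<bar>) \<in> borel_measurable (completion M)"
proof -
  note [measurable] = borel_measurable_random_cdf_at[OF G]
  have "Measurable.pred (completion M) (\<lambda>\<omega>. (SUP x. \<bar>G \<omega> x - F x\<bar>) \<le> c)" for c
  proof (rule pred_cong_AE_completion)
    show "Measurable.pred (completion M) (\<lambda>\<omega>. \<forall>r::rat. \<bar>G \<omega> (of_rat r) - F (of_rat r)\<bar> \<le> c)"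
      by (rule measurable_completion) measurable
    show "AE \<omega> in M. (\<forall>r::rat. \<bar>G \<omega> (of_rat r) - F (of_rat r)\<bar> \<le> c) \<longleftrightarrow> (SUP x. \<bar>G \<omega> x - F x\<bar>) \<le> c"
      using AE_random_cdf[OF G]
    proof eventually_elim
      case (elim \<omega>)
      have "\<bar>G \<omega> x - F x\<bar> \<le> 1" for x
        using is_cdf_nonneg[OF F, of x] is_cdf_le_1[OF F, of x]
          is_cdf_nonneg[OF elim, of x] is_cdf_le_1[OF elim, of x] by linarith
      then have "bdd_above (range (\<lambda>x. \<bar>G \<omega> x - F x\<bar>))" by (intro bdd_aboveI2)
      then have "(SUP x. \<bar>G \<omega> x - F x\<bar>) \<le> c \<longleftrightarrow> (\<forall>x. \<bar>G \<omega> x - F x\<bar> \<le> c)"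
        by (subst cSUP_le_iff) auto
      then show ?case using abs_is_cdf_diff_le_on_Rats[OF F elim] by (metis Rats_cases)
    qed
  qed
  then show ?thesis by (simp add: borel_measurable_iff_le pred_def)
qed

text \<open>\<open>integral_quantile\<close> trades the whole quantile function for the single
  \<open>p\<close>-quantile and a parameter integral of \<open>G \<omega>\<close> itself.\<close>

lemma borel_measurable_LBINT_quantile_random_cdf:
  assumes G: "random_cdf M G" and G1: "AE \<omega> in M. G \<omega> \<in> F1_minus" and p: "0 < p" "p < 1"
  shows "(\<lambda>\<omega>. LBINT u=0..ereal p. real_of_ereal (quantile (G \<omega>) u)) \<in> borel_measurable (completion M)"
proof -
  note [measurable] = borel_measurable_random_cdf[OF G] borel_measurable_quantile_random_cdf[OF G p]
  have [measurable]: "(\<lambda>\<omega>. LBINT x. if G \<omega> x < p then G \<omega> x else 0) \<in> borel_measurable (completion M)"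
    by (rule measurable_completion) measurable
  show ?thesis
  proof (rule borel_measurable_completion_cong_AE)
    \<comment> \<open>\<open>x\<close> lies below the quantile iff \<open>G \<omega> x < p\<close>, which makes the integrand jointly measurable.\<close>
    show "(\<lambda>\<omega>. p * real_of_ereal (quantile (G \<omega>) p) - (LBINT x. if G \<omega> x < p then G \<omega> x else 0))
        \<in> borel_measurable (completion M)" by measurable
    show "AE \<omega> in M. p * real_of_ereal (quantile (G \<omega>) p) - (LBINT x. if G \<omega> x < p then G \<omega> x else 0)
        = (LBINT u=0..ereal p. real_of_ereal (quantile (G \<omega>) u))"
      using G1
    proof eventually_elim
      case (elim \<omega>)
      then have "is_cdf (G \<omega>)" by (simp add: F1_minus_def)
      have "(if G \<omega> x < p then G \<omega> x else 0)
          = indicator {..<real_of_ereal (quantile (G \<omega>) p)} x *\<^sub>R G \<omega> x" for x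
        using quantile_le_iff[OF \<open>is_cdf (G \<omega>)\<close> p, of x] by (cases "G \<omega> x < p") auto
      then show ?case
        unfolding integral_quantile(2)[OF elim p] set_lebesgue_integral_def by simp
    qed
  qed
qed

theorem corollary5p3:
  fixes M :: "'a measure" and N :: "'b measure"
    and F :: "real \<Rightarrow> real" and Fn :: "nat \<Rightarrow> 'a \<Rightarrow> real \<Rightarrow> real"
    and A :: "nat \<Rightarrow> real" and p :: real and L :: "'b \<Rightarrow> real"
  assumes "prob_space M"
    and "0 < p" and "p < 1"
    and "F \<in> F1_minus"
    and "\<And>n. random_cdf M (Fn n)"
    and "\<And>n. AE \<omega> in M. Fn n \<omega> \<in> F1_minus"
    and "tendsto_in_prob M (\<lambda>n \<omega>. real_of_ereal (quantile (Fn n \<omega>) p))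
           (\<lambda>_. real_of_ereal (quantile F p))"
    and "filterlim A at_top sequentially"
    and "Op1 M (\<lambda>n \<omega>. A n * (SUP x. \<bar>Fn n \<omega> x - F x\<bar>))"
    and "prob_space N" and "L \<in> borel_measurable N"
  shows "op1 M (\<lambda>n \<omega>.
            A n * ((LBINT u=0..ereal p. real_of_ereal (quantile (Fn n \<omega>) u))
                   - (LBINT u=0..ereal p. real_of_ereal (quantile F u)))
            - A n * (LBINT x=-\<infinity>..quantile F p. F x - Fn n \<omega> x))
       \<and> (tendsto_in_distr M (\<lambda>n \<omega>.
            A n * ((LBINT u=0..ereal p. real_of_ereal (quantile (Fn n \<omega>) u))
                   - (LBINT u=0..ereal p. real_of_ereal (quantile F u)))) N L
          \<longleftrightarrow>
          tendsto_in_distr M (\<lambda>n \<omega>.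
            A n * ((LBINT x=-\<infinity>..quantile F p. Fn n \<omega> x)
                   - (LBINT x=-\<infinity>..quantile F p. F x))) N (\<lambda>v. - L v))"
proof -
  note M = assms(1) and p = assms(2,3) and F = assms(4) and Fn = assms(5) and Fn1 = assms(6)
  have cF: "is_cdf F" using F by (simp add: F1_minus_def)
  note [measurable] = borel_measurable_is_cdf[OF cF]
  let ?q = "\<lambda>n \<omega>. real_of_ereal (quantile (Fn n \<omega>) p)" and ?S = "\<lambda>n \<omega>. SUP x. \<bar>Fn n \<omega> x - F x\<bar>"
  let ?X = "\<lambda>n \<omega>. A n * ((LBINT u=0..ereal p. real_of_ereal (quantile (Fn n \<omega>) u))
                   - (LBINT u=0..ereal p. real_of_ereal (quantile F u)))"
  let ?Z = "\<lambda>n \<omega>. A n * (LBINT x=-\<infinity>..quantile F p. F x - Fn n \<omega> x)"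
  let ?Y = "\<lambda>n \<omega>. A n * ((LBINT x=-\<infinity>..quantile F p. Fn n \<omega> x) - (LBINT x=-\<infinity>..quantile F p. F x))"
  have X: "?X n \<in> borel_measurable (completion M)" for n
    using borel_measurable_LBINT_quantile_random_cdf[OF Fn Fn1 p] by measurable
  \<comment> \<open>The cutoff is the deterministic quantile of \<open>F\<close>, so this is a
    parameter integral of a jointly measurable function and is measurable even before
    completion.\<close>
  have Y: "?Y n \<in> borel_measurable (completion M)" for n
  proof (rule measurable_completion)
    note [measurable] = borel_measurable_random_cdf[OF Fn]
    show "?Y n \<in> borel_measurable M"
      unfolding LBINT_quantile_eq[OF cF p] set_lebesgue_integral_def by measurable
  qed
  \<comment> \<open>Splitting the integral of a difference needs both integrals to exist, hence the
    restriction to the almost sure event that \<open>Fn n \<omega>\<close> lies in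
    \<open>F1_minus\<close>.\<close>
  have YZ: "AE \<omega> in M. - ?Y n \<omega> = ?Z n \<omega>" for n
    using Fn1[of n]
  proof eventually_elim
    case (elim \<omega>)
    show ?case
      unfolding LBINT_quantile_eq[OF cF p]
      by (subst set_integral_diff) (auto intro: set_integrable_lessThan_F1_minus F elim simp: algebra_simps)
  qed
  have bound: "\<bar>?X n \<omega> - ?Z n \<omega>\<bar> \<le> \<bar>?q n \<omega> - real_of_ereal (quantile F p)\<bar> * \<bar>A n * ?S n \<omega>\<bar>"
    if "Fn n \<omega> \<in> F1_minus" for n \<omega>
  proof -
    \<comment> \<open>Finitely many \<open>A n\<close> may be negative, so the absolute value is
      kept.\<close>
    have "\<bar>?X n \<omega> - ?Z n \<omega>\<bar> \<le> \<bar>A n\<bar> * (\<bar>?q n \<omega> - real_of_ereal (quantile F p)\<bar> * ?S n \<omega>)"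
      using lorenz_remainder_le[OF F that p]
      unfolding right_diff_distrib[symmetric] abs_mult by (intro mult_left_mono) auto
    also have "\<dots> \<le> \<bar>?q n \<omega> - real_of_ereal (quantile F p)\<bar> * \<bar>A n * ?S n \<omega>\<bar>"
      by (auto simp: abs_mult mult.left_commute intro!: mult_left_mono)
    finally show ?thesis .
  qed
  have meas: "?q n \<in> borel_measurable (completion M)" "(\<lambda>\<omega>. A n * ?S n \<omega>) \<in> borel_measurable (completion M)" for n
    using borel_measurable_quantile_random_cdf[OF Fn p] borel_measurable_sup_random_cdf[OF Fn cF] by simp_all
  have 1: "op1 M (\<lambda>n \<omega>. ?X n \<omega> - ?Z n \<omega>)"
  proof (rule op1_mult_Op1[OF M assms(7,9)])
    show "AE \<omega> in M. \<bar>?X n \<omega> - ?Z n \<omega>\<bar>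
        \<le> \<bar>?q n \<omega> - real_of_ereal (quantile F p)\<bar> * \<bar>A n * ?S n \<omega>\<bar>" for n
      using Fn1[of n] by eventually_elim (rule bound)
  qed (use meas in auto)
  \<comment> \<open>The estimate is repeated with \<open>- ?Y n\<close>, which equals
    \<open>?Z n\<close> almost surely and is the sequence to be compared with \<open>?X n\<close> in
    distribution.\<close>
  have 2: "op1 M (\<lambda>n \<omega>. ?X n \<omega> - - ?Y n \<omega>)"
  proof (rule op1_mult_Op1[OF M assms(7,9)])
    show "AE \<omega> in M. \<bar>?X n \<omega> - - ?Y n \<omega>\<bar>
        \<le> \<bar>?q n \<omega> - real_of_ereal (quantile F p)\<bar> * \<bar>A n * ?S n \<omega>\<bar>" for n
      using Fn1[of n] YZ[of n] by eventually_elim (simp only: bound)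
  qed (use meas in auto)
  have mY: "(\<lambda>\<omega>. - ?Y n \<omega>) \<in> borel_measurable (completion M)" for n
    using Y[of n] by (rule borel_measurable_uminus)
  have mL: "(\<lambda>v. - L v) \<in> borel_measurable N"
    using assms(11) by (rule borel_measurable_uminus)
  have "tendsto_in_distr M ?X N L \<longleftrightarrow> tendsto_in_distr M (\<lambda>n \<omega>. - ?Y n \<omega>) N L"
    by (rule tendsto_in_distr_cong_op1[OF M assms(10) X mY assms(11) 2])
  \<comment> \<open>Negation is an involution, so applying the one-sided lemma to
    \<open>- ?Y n\<close> and to \<open>?Y n\<close> gives both directions.\<close>
  also have "\<dots> \<longleftrightarrow> tendsto_in_distr M ?Y N (\<lambda>v. - L v)"
    using tendsto_in_distr_uminus[OF M assms(10) mY assms(11)]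
      tendsto_in_distr_uminus[OF M assms(10) Y mL] by (auto simp only: minus_minus)
  finally show ?thesis using 1 by blast
qed

end
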